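(* Let $A_d\in\mathbb{R}^{n\times n}$, $B_d\in\mathbb{R}^{n\times m}$, let $\pi:\mathbb{R}^n\to\mathbb{R}^m$ be a ReLU feedforward neural network, and consider the closed-loop system $x(t+1)=A_dx(t)+B_d\pi(x(t))$ with $x(0)\in\mathcal{X}_0$, where $\mathcal{X}_0\subset\mathbb{R}^n$ is a constrained zonotope. For $t=1,\dots,T$ let the exact reachable set be $\mathcal{R}_t=\bigcup_{i=1}^{n_t}\mathcal{R}_t^i$ with $\mathcal{R}_t^i=CZ\{\mathbf{c}_i^t,\mathbf{G}_i^t,\mathbf{A}_i^t,\mathbf{b}_i^t\}$, and let $\mathcal{O}_j=CZ\{\mathbf{c}_j^o,\mathbf{G}_j^o,\mathbf{A}_j^o,\mathbf{b}_j^o\}\subset\mathbb{R}^n$, $j=1,\dots,N$, be unsafe sets. Then the state trajectories of the closed-loop system avoid all the unsafe regions if and only if $$\min\left\{\|\xi\|_\infty\ :\ \begin{bmatrix}\mathbf{A}_i^t&\mathbf{0}\\ \mathbf{0}&\mathbf{A}_j^o\\ \mathbf{G}_i^t&-\mathbf{G}_j^o\end{bmatrix}\xi=\begin{bmatrix}\mathbf{b}_i^t\\ \mathbf{b}_j^o\\ \mathbf{c}_j^o-\mathbf{c}_i^t\end{bmatrix}\right\}>1$$ for all $t\in\{1,\dots,T\}$, all $i\in\{1,\dots,n_t\}$ and all $j\in\{1,\dots,N\}$.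
   Context: For $\mathbf{c}\in\mathbb{R}^n$, $\mathbf{G}\in\mathbb{R}^{n\times n_G}$, $\mathbf{A}\in\mathbb{R}^{n_A\times n_G}$, $\mathbf{b}\in\mathbb{R}^{n_A}$, write $CZ\{\mathbf{c},\mathbf{G},\mathbf{A},\mathbf{b}\}=\{\mathbf{G}\xi+\mathbf{c} : \|\xi\|_\infty\le 1,\ \mathbf{A}\xi=\mathbf{b}\}$. A ReLU feedforward neural network $\pi$ with $\ell$ layers, weights $\mathbf{W}^{(k)}$ and biases $\mathbf{v}^{(k)}$ is defined by $x^{(0)}=x$, $x^{(k)}=\max\{0,\mathbf{W}^{(k-1)}x^{(k-1)}+\mathbf{v}^{(k-1)}\}$ (componentwise) for $k=1,\dots,\ell-1$, and $\pi(x)=\mathbf{W}^{(\ell-1)}x^{(\ell-1)}+\mathbf{v}^{(\ell-1)}$. With $\mathbf{f}_{cl}(x)=A_dx+B_d\pi(x)$, the exact reachable sets are $\mathcal{R}_0=\mathcal{X}_0$ and $\mathcal{R}_t=\mathbf{f}_{cl}(\mathcal{R}_{t-1})=\{\mathbf{f}_{cl}(x):x\in\mathcal{R}_{t-1}\}$ for $t=1,\dots,T$; each $\mathcal{R}_t$ is represented as a finite union of constrained zonotopes. "The state trajectories avoid all the unsafe regions" means: for every trajectory with $x(0)\in\mathcal{X}_0$, $x(t)\notin\mathcal{O}_j$ for all $t\in\{1,\dots,T\}$ and $j\in\{1,\dots,N\}$. The minimum over an infeasible constraint set is $+\infty$. *)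

theory Defs
  imports "Jordan_Normal_Form.Matrix" "HOL-Library.Extended_Real"
begin

definition linf_norm :: "real vec \<Rightarrow> real" where
  "linf_norm v = Max (insert 0 ((\<lambda>i. \<bar>v $ i\<bar>) ` {..<dim_vec v}))"
  \<comment> \<open>the inserted 0 only matters for the vector of dimension 0, whose norm is 0\<close>

definition CZ :: "real vec \<Rightarrow> real mat \<Rightarrow> real mat \<Rightarrow> real vec \<Rightarrow> real vec set" where
  "CZ c G A b = {G *\<^sub>v \<xi> + c |\<xi>. \<xi> \<in> carrier_vec (dim_col G) \<and> linf_norm \<xi> \<le> 1 \<and> A *\<^sub>v \<xi> = b}"

text \<open>The numbers of generators and of constraints are arbitrary and may differ from one
  constrained zonotope to another; either of them may be 0.\<close>

definition cz_data :: "nat \<Rightarrow> real vec \<Rightarrow> real mat \<Rightarrow> real mat \<Rightarrow> real vec \<Rightarrow> bool" where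
  "cz_data n c G A b \<longleftrightarrow> c \<in> carrier_vec n \<and>
     (\<exists>nG nA. G \<in> carrier_mat n nG \<and> A \<in> carrier_mat nA nG \<and> b \<in> carrier_vec nA)"

definition constrained_zonotope :: "nat \<Rightarrow> real vec set \<Rightarrow> bool" where
  "constrained_zonotope n X \<longleftrightarrow> (\<exists>c G A b. cz_data n c G A b \<and> X = CZ c G A b)"

definition relu :: "real vec \<Rightarrow> real vec" where
  "relu = map_vec (max 0)"

primrec hidden_layer ::
  "(nat \<Rightarrow> real mat) \<Rightarrow> (nat \<Rightarrow> real vec) \<Rightarrow> real vec \<Rightarrow> nat \<Rightarrow> real vec" where
  "hidden_layer W v x 0 = x"
| "hidden_layer W v x (Suc k) = relu (W k *\<^sub>v hidden_layer W v x k + v k)"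

definition nn_output ::
  "nat \<Rightarrow> (nat \<Rightarrow> real mat) \<Rightarrow> (nat \<Rightarrow> real vec) \<Rightarrow> real vec \<Rightarrow> real vec" where
  "nn_output l W v x = W (l - 1) *\<^sub>v hidden_layer W v x (l - 1) + v (l - 1)"

text \<open>In the following definition, \<open>d k\<close> is the width of layer \<open>k\<close>.\<close>

definition relu_network :: "nat \<Rightarrow> nat \<Rightarrow> (real vec \<Rightarrow> real vec) \<Rightarrow> bool" where
  "relu_network n m \<pi> \<longleftrightarrow> (\<exists>l W v d. l \<ge> 1 \<and> d 0 = n \<and> d l = m \<and>
     (\<forall>k<l. W k \<in> carrier_mat (d (Suc k)) (d k) \<and> v k \<in> carrier_vec (d (Suc k))) \<and>
     (\<forall>x\<in>carrier_vec n. \<pi> x = nn_output l W v x))"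

definition closed_loop ::
  "real mat \<Rightarrow> real mat \<Rightarrow> (real vec \<Rightarrow> real vec) \<Rightarrow> real vec \<Rightarrow> real vec" where
  "closed_loop Ad Bd \<pi> x = Ad *\<^sub>v x + Bd *\<^sub>v \<pi> x"

primrec reach_set :: "('a \<Rightarrow> 'a) \<Rightarrow> 'a set \<Rightarrow> nat \<Rightarrow> 'a set" where
  "reach_set f X0 0 = X0"
| "reach_set f X0 (Suc t) = f ` reach_set f X0 t"

definition trajectory :: "('a \<Rightarrow> 'a) \<Rightarrow> 'a set \<Rightarrow> (nat \<Rightarrow> 'a) \<Rightarrow> bool" where
  "trajectory f X0 x \<longleftrightarrow> x 0 \<in> X0 \<and> (\<forall>t. x (Suc t) = f (x t))"

text \<open>The minimum of the norm over the solutions of a linear system, with value \<open>\<infinity>\<close>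
  when there is no solution (\<open>Inf {} = \<infinity>\<close> for extended reals). When there is one, the infimum
  is attained, as the norm has compact sublevel sets and the solution set is closed.\<close>

definition min_linf_norm :: "real mat \<Rightarrow> real vec \<Rightarrow> ereal" where
  "min_linf_norm M r = Inf {ereal (linf_norm \<xi>) |\<xi>. \<xi> \<in> carrier_vec (dim_col M) \<and> M *\<^sub>v \<xi> = r}"

text \<open>The block matrix with rows \<open>(A, 0)\<close>, \<open>(0, A')\<close>, \<open>(G, -G')\<close>.\<close>

definition intersection_mat :: "real mat \<Rightarrow> real mat \<Rightarrow> real mat \<Rightarrow> real mat \<Rightarrow> real mat" where
  "intersection_mat G A G' A' =
     four_block_mat (A @\<^sub>r 0\<^sub>m (dim_row A') (dim_col A)) (0\<^sub>m (dim_row A) (dim_col A') @\<^sub>r A')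
                    G (- G')"

definition intersection_rhs :: "real vec \<Rightarrow> real vec \<Rightarrow> real vec \<Rightarrow> real vec \<Rightarrow> real vec" where
  "intersection_rhs c b c' b' = b @\<^sub>v b' @\<^sub>v (c' - c)"

end

theory Submission
  imports Defs "HOL-Analysis.Elementary_Metric_Spaces"
begin

text \<open>The reachable set at time \<open>t\<close> is the set of the states at time \<open>t\<close> of all trajectories
  (\<open>mem_reach_set_iff\<close>), so the trajectories avoid the unsafe sets iff no piece
  \<open>CZ c G A b\<close> of a reachable set meets an unsafe set \<open>CZ c' G' A' b'\<close>. A common point
  of these two sets is given by two generator vectors \<open>\<xi>\<close>, \<open>\<xi>'\<close> in the unit boxes with
  \<open>A \<xi> = b\<close>, \<open>A' \<xi>' = b'\<close> and \<open>G \<xi> + c = G' \<xi>' + c'\<close>; these equations are the block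
  system of the theorem for the stacked vector \<open>(\<xi>, \<xi>')\<close> (\<open>intersection_mat_mult_eq_iff\<close>),
  and both vectors lie in their unit boxes iff the stacked one has norm at most 1
  (\<open>linf_norm_append_le_iff\<close>). Hence the sets meet iff the block system has a solution of
  norm at most 1.

  It remains to compare this with the value of the minimum. If that value, which is defined
  as an infimum, is at most 1, a minimising sequence only gives solutions of norm at
  most \<open>1 + \<epsilon>\<close>. By compactness a subsequence converges, and its limit solves the system and has
  norm at most 1 (\<open>min_linf_norm_le_iff\<close>). This attainment is what makes the strict
  inequality in the theorem equivalent to disjointness.\<close>

section \<open>The maximum norm\<close>

lemma linf_norm_nonneg: "0 \<le> linf_norm v"
  unfolding linf_norm_def by (rule Max_ge) auto

lemma linf_norm_le_iff:
  assumes "0 \<le> e"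
  shows "linf_norm v \<le> e \<longleftrightarrow> (\<forall>i<dim_vec v. \<bar>v $ i\<bar> \<le> e)"
  unfolding linf_norm_def using assms by (subst Max_le_iff) auto

lemma abs_index_le_linf_norm: "i < dim_vec v \<Longrightarrow> \<bar>v $ i\<bar> \<le> linf_norm v"
  using linf_norm_le_iff[OF linf_norm_nonneg, of v v] by blast

lemma linf_norm_append_le_iff:
  assumes "0 \<le> e"
  shows "linf_norm (v @\<^sub>v w) \<le> e \<longleftrightarrow> linf_norm v \<le> e \<and> linf_norm w \<le> e"
proof -
  have "(\<forall>i<dim_vec v + dim_vec w. P i) \<longleftrightarrow>
      (\<forall>i<dim_vec v. P i) \<and> (\<forall>i<dim_vec w. P (dim_vec v + i))" for P
  proof (intro iffI allI impI conjI)
    fix i assume split: "(\<forall>i<dim_vec v. P i) \<and> (\<forall>i<dim_vec w. P (dim_vec v + i))"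
      and i: "i < dim_vec v + dim_vec w"
    show "P i"
    proof (cases "i < dim_vec v")
      case False
      then have "i = dim_vec v + (i - dim_vec v)" and "i - dim_vec v < dim_vec w"
        using i by auto
      with split show ?thesis by metis
    qed (use split in simp)
  qed auto
  then show ?thesis
    unfolding linf_norm_le_iff[OF assms] by simp
qed

section \<open>Attainment of the minimum norm\<close>

text \<open>Vectors of all dimensions form one type, which carries no topology. Convergence is
  therefore expressed by coordinates, and compactness comes from the space of functions on
  the finite index set.\<close>

lemma bounded_vec_seq_convergent_subseq:
  fixes \<xi> :: "nat \<Rightarrow> real vec"
  assumes dim: "\<And>k. \<xi> k \<in> carrier_vec d" and bd: "\<And>k. linf_norm (\<xi> k) \<le> B"
  obtains l r where "l \<in> carrier_vec d" and "strict_mono (r :: nat \<Rightarrow> nat)"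
    and "\<And>i. i < d \<Longrightarrow> (\<lambda>k. \<xi> (r k) $ i) \<longlonglongrightarrow> l $ i"
proof -
  have bounded: "bounded ((\<lambda>x. x i) ` range (\<lambda>k i. \<xi> k $ i))" if "i \<in> {..<d}" for i
  proof -
    have "\<bar>\<xi> k $ i\<bar> \<le> B" for k
      using abs_index_le_linf_norm[of i "\<xi> k"] bd[of k] dim[of k] that by auto
    then show ?thesis
      unfolding bounded_iff by auto
  qed
  obtain l r where "strict_mono (r :: nat \<Rightarrow> nat)" and
    conv: "\<forall>\<epsilon>>0. eventually (\<lambda>n. \<forall>i\<in>{..<d}. dist (\<xi> (r n) $ i) (l i :: real) < \<epsilon>) sequentially"
    using compact_lemma_general[of "{..<d}" "\<lambda>x i. x i" "\<lambda>k i. \<xi> k $ i" "\<lambda>x. x"] bounded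
    by auto
  moreover have "(\<lambda>k. \<xi> (r k) $ i) \<longlonglongrightarrow> vec d l $ i" if "i < d" for i
  proof (rule tendstoI)
    fix \<epsilon> :: real assume "\<epsilon> > 0"
    with conv have "eventually (\<lambda>n. \<forall>i\<in>{..<d}. dist (\<xi> (r n) $ i) (l i) < \<epsilon>) sequentially"
      by blast
    then show "eventually (\<lambda>n. dist (\<xi> (r n) $ i) (vec d l $ i) < \<epsilon>) sequentially"
      by (rule eventually_mono) (use that in auto)
  qed
  ultimately show ?thesis
    using that[of "vec d l" r] by simp
qed

lemma mult_mat_vec_tendsto:
  fixes \<xi> :: "nat \<Rightarrow> real vec"
  assumes "M \<in> carrier_mat m d" and "\<And>k. \<xi> k \<in> carrier_vec d" and "l \<in> carrier_vec d"
    and "\<And>i. i < d \<Longrightarrow> (\<lambda>k. \<xi> k $ i) \<longlonglongrightarrow> l $ i" and "j < m"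
  shows "(\<lambda>k. (M *\<^sub>v \<xi> k) $ j) \<longlonglongrightarrow> (M *\<^sub>v l) $ j"
proof -
  have "(M *\<^sub>v v) $ j = (\<Sum>i<d. M $$ (j, i) * v $ i)" if "v \<in> carrier_vec d" for v
    using assms(1,5) that by (auto simp: scalar_prod_def atLeast0LessThan intro!: sum.cong)
  then show ?thesis
    using assms by (auto intro!: tendsto_intros)
qed

text \<open>The equations and the bounds \<open>e + \<epsilon> k\<close> on the norms of a minimising sequence of solutions
  pass to the limit of a subsequence that converges in each coordinate. So a bound on the
  infimum is already met by a solution.\<close>

lemma min_linf_norm_le_iff:
  assumes M: "M \<in> carrier_mat m d" and e: "0 \<le> e"
  shows "min_linf_norm M r \<le> ereal e \<longleftrightarrow>
    (\<exists>\<xi>\<in>carrier_vec d. M *\<^sub>v \<xi> = r \<and> linf_norm \<xi> \<le> e)"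
proof
  assume le: "min_linf_norm M r \<le> ereal e"
  define \<epsilon> where "\<epsilon> k = inverse (real (Suc k))" for k
  have "\<exists>\<xi>\<in>carrier_vec d. M *\<^sub>v \<xi> = r \<and> linf_norm \<xi> < e + \<epsilon> k" for k
  proof -
    have "min_linf_norm M r < ereal (e + \<epsilon> k)"
      by (rule le_less_trans[OF le]) (simp add: \<epsilon>_def)
    then show ?thesis
      using M unfolding min_linf_norm_def Inf_less_iff by auto
  qed
  then obtain \<xi> where \<xi>: "\<And>k. \<xi> k \<in> carrier_vec d" "\<And>k. M *\<^sub>v \<xi> k = r"
    and norm: "\<And>k. linf_norm (\<xi> k) < e + \<epsilon> k"
    by metis
  have "linf_norm (\<xi> k) \<le> e + 1" for k
    using norm[of k] inverse_le_1_iff[of "real (Suc k)"] by (simp add: \<epsilon>_def)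
  then obtain l s where l: "l \<in> carrier_vec d" and s: "strict_mono (s :: nat \<Rightarrow> nat)"
    and conv: "\<And>i. i < d \<Longrightarrow> (\<lambda>k. \<xi> (s k) $ i) \<longlonglongrightarrow> l $ i"
    using bounded_vec_seq_convergent_subseq[of \<xi> d "e + 1"] \<xi>(1) by blast
  have dim_r: "dim_vec r = m"
    using M \<xi>(2)[of 0] by auto
  have "M *\<^sub>v l = r"
  proof (rule eq_vecI)
    fix j assume "j < dim_vec r"
    then have "(\<lambda>k. (M *\<^sub>v \<xi> (s k)) $ j) \<longlonglongrightarrow> (M *\<^sub>v l) $ j"
      using mult_mat_vec_tendsto[of M m d "\<lambda>k. \<xi> (s k)"] M \<xi>(1) l conv dim_r by blast
    then show "(M *\<^sub>v l) $ j = r $ j"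
      using \<xi>(2) by (simp add: LIMSEQ_const_iff)
  qed (use M dim_r in simp)
  moreover have "linf_norm l \<le> e"
    unfolding linf_norm_le_iff[OF e]
  proof (intro allI impI)
    fix i assume i: "i < dim_vec l"
    have "(\<lambda>k. e + \<epsilon> k) \<longlonglongrightarrow> e + 0"
      unfolding \<epsilon>_def by (intro tendsto_intros LIMSEQ_inverse_real_of_nat)
    then have "(\<lambda>k. e + \<epsilon> (s k)) \<longlonglongrightarrow> e"
      using LIMSEQ_subseq_LIMSEQ[OF _ s] by (force simp: o_def)
    moreover have "(\<lambda>k. \<bar>\<xi> (s k) $ i\<bar>) \<longlonglongrightarrow> \<bar>l $ i\<bar>"
      using conv l i by (intro tendsto_rabs) auto
    moreover have "\<bar>\<xi> (s k) $ i\<bar> \<le> e + \<epsilon> (s k)" for k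
      using abs_index_le_linf_norm[of i "\<xi> (s k)"] norm[of "s k"] \<xi>(1)[of "s k"] l i by auto
    ultimately show "\<bar>l $ i\<bar> \<le> e"
      by (blast intro: LIMSEQ_le)
  qed
  ultimately show "\<exists>\<xi>\<in>carrier_vec d. M *\<^sub>v \<xi> = r \<and> linf_norm \<xi> \<le> e"
    using l by blast
next
  assume "\<exists>\<xi>\<in>carrier_vec d. M *\<^sub>v \<xi> = r \<and> linf_norm \<xi> \<le> e"
  then show "min_linf_norm M r \<le> ereal e"
    using M unfolding min_linf_norm_def by (auto intro!: Inf_lower2)
qed

section \<open>Intersection of constrained zonotopes\<close>

lemma append_vec_assoc: "(u @\<^sub>v v) @\<^sub>v w = u @\<^sub>v (v @\<^sub>v w)"
  by (rule eq_vecI) auto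

lemma intersection_mat_carrier:
  assumes "G \<in> carrier_mat n p" "A \<in> carrier_mat q p"
    and "G' \<in> carrier_mat n p'" "A' \<in> carrier_mat q' p'"
  shows "intersection_mat G A G' A' \<in> carrier_mat (q + q' + n) (p + p')"
  using assms unfolding intersection_mat_def append_rows_def by auto

text \<open>The last block row reads \<open>G x - G' y = c' - c\<close>: the point of the first zonotope with
  generator vector \<open>x\<close> equals that of the second with generator vector \<open>y\<close>.\<close>

lemma intersection_mat_mult_eq_iff:
  assumes G: "G \<in> carrier_mat n p" and A: "A \<in> carrier_mat q p"
    and G': "G' \<in> carrier_mat n p'" and A': "A' \<in> carrier_mat q' p'"
    and c: "c \<in> carrier_vec n" and b: "b \<in> carrier_vec q"
    and c': "c' \<in> carrier_vec n" and b': "b' \<in> carrier_vec q'"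
    and x: "x \<in> carrier_vec p" and y: "y \<in> carrier_vec p'"
  shows "intersection_mat G A G' A' *\<^sub>v (x @\<^sub>v y) = intersection_rhs c b c' b' \<longleftrightarrow>
    A *\<^sub>v x = b \<and> A' *\<^sub>v y = b' \<and> G *\<^sub>v x + c = G' *\<^sub>v y + c'"
proof -
  have rows: "0\<^sub>m q' p *\<^sub>v x = 0\<^sub>v q'" "0\<^sub>m q p' *\<^sub>v y = 0\<^sub>v q" "- G' *\<^sub>v y = - (G' *\<^sub>v y)"
    using x y G' by auto
  have top: "(A @\<^sub>r 0\<^sub>m q' p) *\<^sub>v x + (0\<^sub>m q p' @\<^sub>r A') *\<^sub>v y = (A *\<^sub>v x) @\<^sub>v (A' *\<^sub>v y)"
  proof -
    have "(A @\<^sub>r 0\<^sub>m q' p) *\<^sub>v x = (A *\<^sub>v x) @\<^sub>v 0\<^sub>v q'"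
      using mat_mult_append[OF A zero_carrier_mat x] rows(1) by simp
    moreover have "(0\<^sub>m q p' @\<^sub>r A') *\<^sub>v y = 0\<^sub>v q @\<^sub>v (A' *\<^sub>v y)"
      using mat_mult_append[OF zero_carrier_mat A' y] rows(2) by simp
    moreover have "((A *\<^sub>v x) @\<^sub>v 0\<^sub>v q') + (0\<^sub>v q @\<^sub>v (A' *\<^sub>v y)) = (A *\<^sub>v x) @\<^sub>v (A' *\<^sub>v y)"
      using A A' x y by (subst append_vec_add[of _ q _ _ q']) auto
    ultimately show ?thesis by simp
  qed
  have "intersection_mat G A G' A' *\<^sub>v (x @\<^sub>v y) =
      ((A @\<^sub>r 0\<^sub>m q' p) *\<^sub>v x + (0\<^sub>m q p' @\<^sub>r A') *\<^sub>v y) @\<^sub>v (G *\<^sub>v x + (- G') *\<^sub>v y)"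
    unfolding intersection_mat_def using A A' G G' x y
    by (subst four_block_mat_mult_vec[of _ "q + q'" p _ p' _ n]) auto
  then have prod: "intersection_mat G A G' A' *\<^sub>v (x @\<^sub>v y) =
      (A *\<^sub>v x) @\<^sub>v (A' *\<^sub>v y) @\<^sub>v (G *\<^sub>v x - G' *\<^sub>v y)"
    unfolding top append_vec_assoc rows using G G' x y by auto
  have "G *\<^sub>v x - G' *\<^sub>v y = c' - c \<longleftrightarrow> G *\<^sub>v x + c = G' *\<^sub>v y + c'"
  proof -
    have "u - v = c' - c \<longleftrightarrow> u + c = v + c'" if "u \<in> carrier_vec n" "v \<in> carrier_vec n" for u v
      using that c c' by (auto simp: vec_eq_iff algebra_simps)
    then show ?thesis using G G' x y by simp
  qed
  then show ?thesis
    unfolding prod intersection_rhs_def using A A' x y b b'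
    by (simp add: append_vec_eq[of _ q] append_vec_eq[of _ q'])
qed

lemma CZ_Int_nonempty_iff:
  assumes cz: "cz_data n c G A b" and cz': "cz_data n c' G' A' b'"
  shows "CZ c G A b \<inter> CZ c' G' A' b' \<noteq> {} \<longleftrightarrow>
    min_linf_norm (intersection_mat G A G' A') (intersection_rhs c b c' b') \<le> 1"
proof -
  obtain p q where G: "G \<in> carrier_mat n p" and A: "A \<in> carrier_mat q p"
    and c: "c \<in> carrier_vec n" and b: "b \<in> carrier_vec q"
    using cz unfolding cz_data_def by blast
  obtain p' q' where G': "G' \<in> carrier_mat n p'" and A': "A' \<in> carrier_mat q' p'"
    and c': "c' \<in> carrier_vec n" and b': "b' \<in> carrier_vec q'"
    using cz' unfolding cz_data_def by blast
  let ?M = "intersection_mat G A G' A'" and ?r = "intersection_rhs c b c' b'"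
  have "CZ c G A b \<inter> CZ c' G' A' b' \<noteq> {} \<longleftrightarrow>
      (\<exists>x\<in>carrier_vec p. \<exists>y\<in>carrier_vec p'. linf_norm x \<le> 1 \<and> linf_norm y \<le> 1 \<and>
        A *\<^sub>v x = b \<and> A' *\<^sub>v y = b' \<and> G *\<^sub>v x + c = G' *\<^sub>v y + c')"
    using G G' unfolding CZ_def by fastforce
  also have "\<dots> \<longleftrightarrow> (\<exists>x\<in>carrier_vec p. \<exists>y\<in>carrier_vec p'.
      ?M *\<^sub>v (x @\<^sub>v y) = ?r \<and> linf_norm (x @\<^sub>v y) \<le> 1)"
    using intersection_mat_mult_eq_iff[OF G A G' A' c b c' b'] linf_norm_append_le_iff[of 1]
    by auto
  \<comment> \<open>Every vector of dimension \<open>p + p'\<close> is the concatenation of its first and last parts.\<close>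
  also have "\<dots> \<longleftrightarrow> (\<exists>\<xi>\<in>carrier_vec (p + p'). ?M *\<^sub>v \<xi> = ?r \<and> linf_norm \<xi> \<le> 1)"
    by (metis append_carrier_vec vec_first_last_append vec_first_carrier vec_last_carrier)
  also have "\<dots> \<longleftrightarrow> min_linf_norm ?M ?r \<le> 1"
    using min_linf_norm_le_iff[OF intersection_mat_carrier[OF G A G' A'], of 1]
    by (simp add: one_ereal_def)
  finally show ?thesis .
qed

section \<open>Reachable sets and trajectories\<close>

text \<open>A point of the reachable set at time \<open>t\<close> is an iterate of \<open>f\<close> at some initial state, and
  the trajectory from that state passes through it at time \<open>t\<close>.\<close>

lemma mem_reach_set_iff: "y \<in> reach_set f X0 t \<longleftrightarrow> (\<exists>x. trajectory f X0 x \<and> x t = y)"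
proof
  have "\<exists>x0\<in>X0. y = (f ^^ t) x0" if "y \<in> reach_set f X0 t" for y
    using that by (induction t arbitrary: y) fastforce+
  moreover have "trajectory f X0 (\<lambda>t. (f ^^ t) x0)" if "x0 \<in> X0" for x0
    using that by (simp add: trajectory_def)
  ultimately show "y \<in> reach_set f X0 t \<Longrightarrow> \<exists>x. trajectory f X0 x \<and> x t = y"
    by blast
next
  have "x t \<in> reach_set f X0 t" if "trajectory f X0 x" for x
    using that by (induction t) (auto simp: trajectory_def)
  then show "\<exists>x. trajectory f X0 x \<and> x t = y \<Longrightarrow> y \<in> reach_set f X0 t"
    by blast
qed

theorem proposition1:
  fixes n m T N :: nat
    and Ad Bd :: "real mat"
    and \<pi> :: "real vec \<Rightarrow> real vec"
    and X0 :: "real vec set"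
    and nt :: "nat \<Rightarrow> nat"
    and c :: "nat \<Rightarrow> nat \<Rightarrow> real vec" and G A :: "nat \<Rightarrow> nat \<Rightarrow> real mat"
    and b :: "nat \<Rightarrow> nat \<Rightarrow> real vec"
    and Ob :: "nat \<Rightarrow> real vec set"
    and co :: "nat \<Rightarrow> real vec" and Go Ao :: "nat \<Rightarrow> real mat" and bo :: "nat \<Rightarrow> real vec"
  assumes "Ad \<in> carrier_mat n n" and "Bd \<in> carrier_mat n m"
    and "relu_network n m \<pi>"
    and "constrained_zonotope n X0"
    and "\<And>t i. t \<in> {1..T} \<Longrightarrow> i \<in> {1..nt t} \<Longrightarrow> cz_data n (c t i) (G t i) (A t i) (b t i)"
    and "\<And>t. t \<in> {1..T} \<Longrightarrow>
           reach_set (closed_loop Ad Bd \<pi>) X0 t = (\<Union>i\<in>{1..nt t}. CZ (c t i) (G t i) (A t i) (b t i))"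
    and "\<And>j. j \<in> {1..N} \<Longrightarrow> cz_data n (co j) (Go j) (Ao j) (bo j)"
    and "\<And>j. j \<in> {1..N} \<Longrightarrow> Ob j = CZ (co j) (Go j) (Ao j) (bo j)"
  shows "(\<forall>x. trajectory (closed_loop Ad Bd \<pi>) X0 x \<longrightarrow> (\<forall>t\<in>{1..T}. \<forall>j\<in>{1..N}. x t \<notin> Ob j)) \<longleftrightarrow>
         (\<forall>t\<in>{1..T}. \<forall>i\<in>{1..nt t}. \<forall>j\<in>{1..N}.
            min_linf_norm (intersection_mat (G t i) (A t i) (Go j) (Ao j))
                          (intersection_rhs (c t i) (b t i) (co j) (bo j)) > 1)"
proof -
  let ?f = "closed_loop Ad Bd \<pi>"
  let ?R = "\<lambda>t i. CZ (c t i) (G t i) (A t i) (b t i)"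
  have "(\<forall>x. trajectory ?f X0 x \<longrightarrow> (\<forall>t\<in>{1..T}. \<forall>j\<in>{1..N}. x t \<notin> Ob j)) \<longleftrightarrow>
      (\<forall>t\<in>{1..T}. \<forall>j\<in>{1..N}. reach_set ?f X0 t \<inter> Ob j = {})"
    by (auto simp: disjoint_iff mem_reach_set_iff)
  also have "\<dots> \<longleftrightarrow> (\<forall>t\<in>{1..T}. \<forall>i\<in>{1..nt t}. \<forall>j\<in>{1..N}. ?R t i \<inter> Ob j = {})"
    using assms(6) by (simp add: Int_UN_distrib2) blast
  also have "\<dots> \<longleftrightarrow> (\<forall>t\<in>{1..T}. \<forall>i\<in>{1..nt t}. \<forall>j\<in>{1..N}.
      min_linf_norm (intersection_mat (G t i) (A t i) (Go j) (Ao j))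
        (intersection_rhs (c t i) (b t i) (co j) (bo j)) > 1)"
    using CZ_Int_nonempty_iff[OF assms(5) assms(7)] assms(8)
    by (intro ball_cong refl) (metis not_le)
  finally show ?thesis .
qed

end
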